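(* Assume that, in the standard distribution-testing model, the sample complexity of testing whether a distribution over a domain of size $O(m)$ is $m$-grained is $\Omega(m/\log m)$. Then for every $m\le n$, testing (with some constant proximity parameter $\epsilon>0$) whether a distribution over $\{0,1\}^n$ is uniform over some $m$-subset requires $\Omega(m/\log m)$ queries in the DoHO model.
   Context: A distribution $P$ is $m$-grained if $P(x)$ is an integer multiple of $1/m$ for every $x$. In the standard distribution-testing model, a tester receives independent full samples of an unknown distribution and must accept members of the property with probability at least $2/3$ and reject distributions that are $\epsilon$-far in total variation distance from the property with probability at least $2/3$. For $x,y\in\{0,1\}^n$ let $\Delta_H(x,y)=\frac1n|\{i:x_i\neq y_i\}|$. The DoHO-model distance between distributions $P,Q$ over $\{0,1\}^n$ is $\min\sum_{x,y}w_{x,y}\Delta_H(x,y)$ over nonnegative $w_{x,y}$ with $\sum_y w_{x,y}=P(x)$, $\sum_x w_{x,y}=Q(y)$. A DoHO-model tester gets oracle access to independent samples of $P$ over $\{0,1\}^n$, may query individual bits of samples, and must accept members with probability at least $2/3$ and reject distributions $\epsilon$-far (in the DoHO distance) from the property with probability at least $2/3$; its query complexity is the total number of bit queries. *)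

theory Defs
  imports
    "HOL-Probability.Probability"
    "HOL-Library.Landau_Symbols"
    "HOL-Library.Extended_Nat"
begin

definition far_from :: "('d \<Rightarrow> 'd \<Rightarrow> real) \<Rightarrow> 'd set \<Rightarrow> real \<Rightarrow> 'd \<Rightarrow> bool" where
  "far_from \<delta> \<P> \<epsilon> P \<longleftrightarrow> (\<forall>Q\<in>\<P>. \<delta> P Q > \<epsilon>)"

text \<open>
  The common acceptance criterion of both models. The distributions under consideration are those
  supported on \<open>D\<close>, and \<open>verdict P\<close> is the distribution of the output (\<open>True\<close> = accept) of a tester
  that is run on samples of \<open>P\<close>.
\<close>

definition tests ::
  "'a set \<Rightarrow> ('a pmf \<Rightarrow> 'a pmf \<Rightarrow> real) \<Rightarrow> 'a pmf set \<Rightarrow> real \<Rightarrow> ('a pmf \<Rightarrow> bool pmf) \<Rightarrow> bool" where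
  "tests D \<delta> \<P> \<epsilon> verdict \<longleftrightarrow>
     (\<forall>P. set_pmf P \<subseteq> D \<longrightarrow> P \<in> \<P> \<longrightarrow> pmf (verdict P) True \<ge> 2 / 3) \<and>
     (\<forall>P. set_pmf P \<subseteq> D \<longrightarrow> far_from \<delta> \<P> \<epsilon> P \<longrightarrow> pmf (verdict P) False \<ge> 2 / 3)"


section \<open>The standard model\<close>

definition tv_distance :: "'a set \<Rightarrow> 'a pmf \<Rightarrow> 'a pmf \<Rightarrow> real" where
  "tv_distance D P Q = (\<Sum>x\<in>D. \<bar>pmf P x - pmf Q x\<bar>) / 2"

text \<open>A randomized tester maps the list of samples to a distribution of verdicts.\<close>

definition standard_verdict :: "nat \<Rightarrow> ('a list \<Rightarrow> bool pmf) \<Rightarrow> 'a pmf \<Rightarrow> bool pmf" where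
  "standard_verdict s T P = bind_pmf (replicate_pmf s P) T"

text \<open>The infimum is \<open>\<infinity>\<close> if no tester exists.\<close>

definition sample_complexity :: "'a set \<Rightarrow> 'a pmf set \<Rightarrow> real \<Rightarrow> enat" where
  "sample_complexity D \<P> \<epsilon> =
     (INF s\<in>{s. \<exists>T. tests D (tv_distance D) \<P> \<epsilon> (standard_verdict s T)}. enat s)"

definition grained :: "nat \<Rightarrow> 'a pmf \<Rightarrow> bool" where
  "grained m P \<longleftrightarrow> (\<forall>x. \<exists>k::int. pmf P x = of_int k * (1 / real m))"

text \<open>A domain of size \<open>N\<close> is represented by \<open>{..<N}\<close>.\<close>

definition grained_distributions :: "nat \<Rightarrow> nat \<Rightarrow> nat pmf set" where
  "grained_distributions N m = {P. set_pmf P \<subseteq> {..<N} \<and> grained m P}"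


section \<open>The DoHO model\<close>

definition cube :: "nat \<Rightarrow> bool list set" where
  "cube n = {x. length x = n}"

definition rel_hamming :: "nat \<Rightarrow> bool list \<Rightarrow> bool list \<Rightarrow> real" where
  "rel_hamming n x y = real (card {i. i < n \<and> x ! i \<noteq> y ! i}) / real n"

definition transports ::
  "nat \<Rightarrow> bool list pmf \<Rightarrow> bool list pmf \<Rightarrow> (bool list \<Rightarrow> bool list \<Rightarrow> real) \<Rightarrow> bool" where
  "transports n P Q w \<longleftrightarrow>
     (\<forall>x\<in>cube n. \<forall>y\<in>cube n. w x y \<ge> 0) \<and>
     (\<forall>x\<in>cube n. (\<Sum>y\<in>cube n. w x y) = pmf P x) \<and>
     (\<forall>y\<in>cube n. (\<Sum>x\<in>cube n. w x y) = pmf Q y)"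

text \<open>
  For \<open>P\<close>, \<open>Q\<close> supported on \<open>cube n\<close> the infimum is a minimum: it is the value of a feasible linear
  program whose polytope is compact.
\<close>

definition doho_distance :: "nat \<Rightarrow> bool list pmf \<Rightarrow> bool list pmf \<Rightarrow> real" where
  "doho_distance n P Q =
     Inf {(\<Sum>x\<in>cube n. \<Sum>y\<in>cube n. w x y * rel_hamming n x y) | w. transports n P Q w}"

text \<open>
  A deterministic adaptive algorithm: \<open>Query i j t u\<close> asks for bit \<open>j\<close> of sample \<open>i\<close> and continues
  with \<open>t\<close> if that bit is \<open>True\<close> and with \<open>u\<close> otherwise.
\<close>

datatype query_tree = Output bool | Query nat nat query_tree query_tree

primrec run_tree :: "query_tree \<Rightarrow> bool list list \<Rightarrow> bool" where
  "run_tree (Output b) xs = b"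
| "run_tree (Query i j t u) xs = (if xs ! i ! j then run_tree t xs else run_tree u xs)"

primrec query_depth :: "query_tree \<Rightarrow> nat" where
  "query_depth (Output b) = 0"
| "query_depth (Query i j t u) = Suc (max (query_depth t) (query_depth u))"

primrec valid_tree :: "nat \<Rightarrow> nat \<Rightarrow> query_tree \<Rightarrow> bool" where
  "valid_tree s n (Output b) \<longleftrightarrow> True"
| "valid_tree s n (Query i j t u) \<longleftrightarrow> i < s \<and> j < n \<and> valid_tree s n t \<and> valid_tree s n u"

text \<open>
  A randomized algorithm with oracle access to \<open>s\<close> independent samples is a distribution of
  deterministic ones; its internal randomness is independent of the samples.
\<close>

definition doho_verdict :: "nat \<Rightarrow> query_tree pmf \<Rightarrow> bool list pmf \<Rightarrow> bool pmf" where
  "doho_verdict s T P =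
     bind_pmf T (\<lambda>t. map_pmf (run_tree t) (replicate_pmf s P))"

definition doho_tester ::
  "nat \<Rightarrow> bool list pmf set \<Rightarrow> real \<Rightarrow> nat \<Rightarrow> nat \<Rightarrow> query_tree pmf \<Rightarrow> bool" where
  "doho_tester n \<P> \<epsilon> s q T \<longleftrightarrow>
     (\<forall>t\<in>set_pmf T. valid_tree s n t \<and> query_depth t \<le> q) \<and>
     tests (cube n) (doho_distance n) \<P> \<epsilon> (doho_verdict s T)"

text \<open>
  Only bit queries are charged: the number \<open>s\<close> of samples made available to the tester is arbitrary.
\<close>

definition doho_query_complexity :: "nat \<Rightarrow> bool list pmf set \<Rightarrow> real \<Rightarrow> enat" where
  "doho_query_complexity n \<P> \<epsilon> = (INF q\<in>{q. \<exists>s T. doho_tester n \<P> \<epsilon> s q T}. enat q)"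

text \<open>\<open>S \<noteq> {}\<close> only matters for \<open>m = 0\<close>, where \<open>pmf_of_set S\<close> would be unspecified.\<close>

definition uniform_on_subset :: "nat \<Rightarrow> nat \<Rightarrow> bool list pmf set" where
  "uniform_on_subset n m = {pmf_of_set S | S. S \<subseteq> cube n \<and> card S = m \<and> S \<noteq> {}}"

end

theory Submission
  imports Defs
begin

text \<open>
  Embed \<open>{..<N}\<close> into the cube by a code \<open>C\<close> of constant relative distance. Decoding to the nearest
  codeword turns the uniform distribution on any \<open>m\<close>-subset into an \<open>m\<close>-grained distribution, and the
  mass that it misplaces is at most a constant times the transportation cost; hence distributions far
  from grained are mapped to distributions that are far in the DoHO distance.

  If \<open>P\<close> is \<open>m\<close>-grained, write it as the image of the uniform distribution on \<open>{..<m}\<close> under a map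
  \<open>x\<close>. For every shift \<open>r < n\<close> the strings obtained from \<open>C (x k)\<close> by flipping bit
  \<open>(k + r) mod n\<close> are distinct, so they form an \<open>m\<close>-subset and the tester accepts the uniform
  distribution on it. A single query notices the flip for exactly one shift, so averaging over \<open>r\<close>
  shows that the tester also accepts \<open>C P\<close> with probability at least \<open>2/3 - q/n\<close>.

  A tester with \<open>q\<close> queries looks at no more than \<open>q\<close> samples, however many are available, and a
  majority vote over three runs compensates the loss \<open>q/n\<close>. For the finitely many small \<open>m\<close> it
  suffices that a tester must ask at least one query.
\<close>

section \<open>A code of constant relative distance\<close>

text \<open>Adding or removing \<open>e\<close> is an involution on the subsets of \<open>L\<close>.
  Since \<open>e\<close> lies in exactly one of \<open>A\<close> and \<open>A'\<close>, it changes
  exactly one of the two parities, so it exchanges the counted subsets with all the others.\<close>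

lemma card_parity_half:
  assumes "finite L" "e \<in> L" "e \<in> A \<longleftrightarrow> e \<notin> A'" "A \<subseteq> L" "A' \<subseteq> L"
  shows "2 * card {B \<in> Pow L. odd (card (A \<inter> B)) \<noteq> odd (card (A' \<inter> B))} = 2 ^ card L"
proof -
  define D where "D = {B \<in> Pow L. odd (card (A \<inter> B)) \<noteq> odd (card (A' \<inter> B))}"
  define g where "g B = (if e \<in> B then B - {e} else insert e B)" for B
  have gg: "g (g B) = B" for B by (auto simp: g_def)
  have gP: "g B \<in> Pow L" if "B \<in> Pow L" for B using that assms by (auto simp: g_def)
  have par: "odd (card (X \<inter> g B)) \<longleftrightarrow> (odd (card (X \<inter> B)) \<noteq> (e \<in> X))"
    if "B \<in> Pow L" "X \<subseteq> L" for B X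
  proof -
    have fin: "finite (X \<inter> B)" using that assms(1) by (meson finite_Int finite_subset)
    show ?thesis
    proof (cases "e \<in> X")
      case False
      then have "X \<inter> g B = X \<inter> B" by (auto simp: g_def)
      with False show ?thesis by simp
    next
      case True
      show ?thesis
      proof (cases "e \<in> B")
        case B: True
        have "X \<inter> B = insert e (X \<inter> g B)" "e \<notin> X \<inter> g B" using B True by (auto simp: g_def)
        then have "card (X \<inter> B) = Suc (card (X \<inter> g B))"
          using fin by (metis card_insert_disjoint finite_insert)
        then show ?thesis using True by simp
      next
        case B: False
        have "X \<inter> g B = insert e (X \<inter> B)" using B True by (auto simp: g_def)
        then have "card (X \<inter> g B) = Suc (card (X \<inter> B))" using fin B by simp
        then show ?thesis using True by simp
      qed
    qed
  qed
  have flip: "g B \<in> D \<longleftrightarrow> B \<notin> D" if "B \<in> Pow L" for B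
    using par[OF that assms(4)] par[OF that assms(5)] gP[OF that] that assms(3)
    unfolding D_def by blast
  have "bij_betw g D (Pow L - D)"
    by (rule bij_betwI[where g = g]) (use flip gP gg in \<open>auto simp: D_def\<close>)
  then have "card D = card (Pow L - D)" by (rule bij_betw_same_card)
  moreover have "card (Pow L) = card D + card (Pow L - D)"
  proof -
    have "D \<subseteq> Pow L" "finite (Pow L)" using assms(1) by (auto simp: D_def)
    then show ?thesis using card_Diff_subset[of D "Pow L"] card_mono[of "Pow L" D]
      by (simp add: finite_subset)
  qed
  ultimately show ?thesis using assms(1) by (simp add: card_Pow D_def)
qed

text \<open>Rows of Sylvester's Hadamard matrix: rows and columns are identified with the subsets of
  an \<open>l\<close>-element set, and an entry is the parity of the intersection.\<close>

lemma ex_hadamard: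
  "\<exists>H :: nat \<Rightarrow> nat \<Rightarrow> bool. \<forall>a<2^l. \<forall>b<2^l. a \<noteq> b \<longrightarrow>
     2 * card {i. i < 2^l \<and> H a i \<noteq> H b i} = 2^l"
proof -
  have "\<exists>f. bij_betw f {..<2^l::nat} (Pow {..<l})"
    by (intro finite_same_card_bij) (auto simp: card_Pow)
  then obtain f where f: "bij_betw f {..<2^l::nat} (Pow {..<l})" by blast
  define H where "H a i = odd (card (f a \<inter> f i))" for a i
  have "2 * card {i. i < 2^l \<and> H a i \<noteq> H b i} = 2^l" if "a < 2^l" "b < 2^l" "a \<noteq> b" for a b
  proof -
    have sub: "f a \<subseteq> {..<l}" "f b \<subseteq> {..<l}" using f that by (auto dest!: bij_betwE)
    have "f a \<noteq> f b" using f that by (auto simp: bij_betw_def inj_on_def)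
    then obtain e where e: "e \<in> f a \<longleftrightarrow> e \<notin> f b" by blast
    have eL: "e \<in> {..<l}" using e sub by blast
    have im: "f ` {..<2^l} = Pow {..<l}" and inj: "inj_on f {..<2^l}"
      using f by (auto simp: bij_betw_def)
    have "{B \<in> Pow {..<l}. odd (card (f a \<inter> B)) \<noteq> odd (card (f b \<inter> B))}
        = f ` {i \<in> {..<2^l}. H a i \<noteq> H b i}"
      unfolding im[symmetric] H_def by blast
    then have "bij_betw f {i \<in> {..<2^l}. H a i \<noteq> H b i}
        {B \<in> Pow {..<l}. odd (card (f a \<inter> B)) \<noteq> odd (card (f b \<inter> B))}"
      by (auto simp: bij_betw_def intro: inj_on_subset[OF inj])
    from bij_betw_same_card[OF this] card_parity_half[OF _ eL e sub]
    show ?thesis by simp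
  qed
  then show ?thesis by blast
qed

lemma ex_pow2_bracket:
  assumes "n \<ge> (2::nat)"
  shows "\<exists>l. 2 ^ (l+1) \<le> n \<and> n < 2 ^ (l+2)"
proof -
  obtain k where k: "2 ^ k \<le> n" "n < 2 ^ (k+1)"
    using ex_power_ivl1[of 2 n] assms by auto
  have "k \<noteq> 0" using k assms by (intro notI) auto
  then obtain l where "k = Suc l" by (cases k) auto
  with k show ?thesis by (intro exI[of _ l]) auto
qed

text \<open>A number below \<open>M * M\<close> has two digits in base \<open>M\<close>. Each digit
  is written as a Hadamard row of length \<open>M\<close>, and the rest is padding. A single block
  would give only \<open>M\<close> codewords, too few for a domain whose size is a large multiple of
  \<open>n\<close>.\<close>

lemma ex_code:
  assumes n: "n \<ge> 2" and N: "16 * N \<le> n\<^sup>2"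
  shows "\<exists>C. (\<forall>x<N. C x \<in> cube n) \<and>
    (\<forall>x<N. \<forall>y<N. x \<noteq> y \<longrightarrow> 1/8 \<le> rel_hamming n (C x) (C y))"
proof -
  obtain l where l: "2 ^ (l+1) \<le> n" "n < 2 ^ (l+2)" using ex_pow2_bracket[OF n] by blast
  define M :: nat where "M = 2 ^ l"
  have M: "2 * M \<le> n" "n < 4 * M" using l by (auto simp: M_def)
  have "n\<^sup>2 \<le> (4 * M)\<^sup>2" using M by (intro power_mono) auto
  then have NM: "N \<le> M * M" using N by (simp add: power2_eq_square)
  obtain H where H: "\<And>a b. a < M \<Longrightarrow> b < M \<Longrightarrow> a \<noteq> b \<Longrightarrow>
      2 * card {i. i < M \<and> H a i \<noteq> (H b i :: bool)} = M"
    using ex_hadamard[of l] unfolding M_def by blast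
  define C where "C x = map (\<lambda>i. if i < M then H (x mod M) i
      else if i < 2 * M then H (x div M) (i - M) else False) [0..<n]" for x
  have nth: "C x ! i = H (x mod M) i" "C x ! (M + i) = H (x div M) i" if "i < M" for x i
    using that M by (auto simp: C_def)
  have "1/8 \<le> rel_hamming n (C x) (C y)" if xy: "x < N" "y < N" "x \<noteq> y" for x y
  proof -
    define I where "I = {i. i < n \<and> C x ! i \<noteq> C y ! i}"
    have fI: "finite I" by (auto simp: I_def)
    have M0: "M > 0" by (simp add: M_def)
    have small: "x mod M < M" "y mod M < M" "x div M < M" "y div M < M"
      using xy NM M0 by (auto simp: less_mult_imp_div_less)
    \<comment> \<open>Distinct numbers differ in a digit, and the rows of distinct digits differ in
      half of their block. With \<open>n < 4 * M\<close> this is at least an eighth of all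
      positions.\<close>
    have "M \<le> 2 * card I"
    proof (cases "x mod M = y mod M")
      case False
      have "card {i. i < M \<and> H (x mod M) i \<noteq> H (y mod M) i} \<le> card I"
        using M by (intro card_mono fI) (auto simp: I_def nth)
      with H[OF small(1,2) False] show ?thesis by simp
    next
      case True
      then have False': "x div M \<noteq> y div M" using xy(3) by (metis div_mult_mod_eq)
      have "card ((+) M ` {i. i < M \<and> H (x div M) i \<noteq> H (y div M) i}) \<le> card I"
        using M by (intro card_mono fI) (auto simp: I_def nth)
      then have "card {i. i < M \<and> H (x div M) i \<noteq> H (y div M) i} \<le> card I"
        by (subst (asm) card_image) auto
      with H[OF small(3,4) False'] show ?thesis by simp
    qed
    then have "n \<le> 8 * card I" using M by linarith
    then have "real n \<le> 8 * real (card I)" by linarith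
    then have "1/8 \<le> real (card I) / real n" using n by (simp add: field_simps)
    then show ?thesis unfolding rel_hamming_def I_def .
  qed
  moreover have "C x \<in> cube n" for x by (simp add: C_def cube_def)
  ultimately show ?thesis by blast
qed

section \<open>Transportation cost and decoding\<close>

lemma finite_cube [simp]: "finite (cube n)"
  using finite_lists_length_eq[of "UNIV :: bool set" n] by (simp add: cube_def)

lemma rel_hamming_nonneg: "0 \<le> rel_hamming n x y"
  by (simp add: rel_hamming_def)

lemma rel_hamming_self [simp]: "rel_hamming n x x = 0"
  by (simp add: rel_hamming_def)

lemma rel_hamming_commute: "rel_hamming n x y = rel_hamming n y x"
  by (simp add: rel_hamming_def eq_commute)

lemma rel_hamming_triangle: "rel_hamming n x z \<le> rel_hamming n x y + rel_hamming n y z"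
proof -
  have "card {i. i < n \<and> x ! i \<noteq> z ! i} \<le>
      card ({i. i < n \<and> x ! i \<noteq> y ! i} \<union> {i. i < n \<and> y ! i \<noteq> z ! i})"
    by (intro card_mono) auto
  also have "\<dots> \<le> card {i. i < n \<and> x ! i \<noteq> y ! i} + card {i. i < n \<and> y ! i \<noteq> z ! i}"
    by (rule card_Un_le)
  finally show ?thesis
    by (simp add: rel_hamming_def add_divide_distrib[symmetric] divide_right_mono)
qed

lemma pmf_map_finite:
  assumes "set_pmf P \<subseteq> A" "finite A"
  shows "pmf (map_pmf D P) x = (\<Sum>z\<in>A. pmf P z * of_bool (D z = x))"
proof -
  have "pmf (map_pmf D P) x = measure P ({z \<in> A. D z = x} \<inter> set_pmf P)"
    unfolding pmf_map
    by (subst measure_Int_set_pmf[symmetric], rule arg_cong[where f = "measure P"]) (use assms in auto)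
  also have "\<dots> = (\<Sum>z\<in>{z \<in> A. D z = x}. pmf P z)"
    using assms by (simp add: measure_Int_set_pmf measure_measure_pmf_finite)
  also have "\<dots> = (\<Sum>z\<in>A. pmf P z * of_bool (D z = x))"
    using assms by (intro sum.mono_neutral_cong_left) auto
  finally show ?thesis .
qed

text \<open>Mass moved from \<open>z\<close> to \<open>y\<close> matters after decoding only if
  \<open>D z\<close> and \<open>D y\<close> differ. Then each unit adds at most 2 to the sum of
  absolute differences, hence at most 1 to the total variation distance, and costs at least
  \<kappa>. Separation is required only on the support of \<open>P\<close>, because nothing is moved
  out of other points.\<close>

lemma transport_tv:
  assumes tr: "transports n P Q w" and P: "set_pmf P \<subseteq> cube n" and Q: "set_pmf Q \<subseteq> cube n"
    and X: "finite X"
    and sep: "\<And>z y. z \<in> set_pmf P \<Longrightarrow> y \<in> cube n \<Longrightarrow> D z \<noteq> D y \<Longrightarrow> \<kappa> \<le> rel_hamming n z y"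
  shows "\<kappa> * tv_distance X (map_pmf D P) (map_pmf D Q)
    \<le> (\<Sum>z\<in>cube n. \<Sum>y\<in>cube n. w z y * rel_hamming n z y)"
proof -
  have w0: "w z y \<ge> 0" if "z \<in> cube n" "y \<in> cube n" for z y using tr that by (auto simp: transports_def)
  have p: "pmf (map_pmf D P) x = (\<Sum>z\<in>cube n. \<Sum>y\<in>cube n. w z y * of_bool (D z = x))" for x
    using tr by (simp add: pmf_map_finite[OF P] transports_def sum_distrib_right[symmetric])
  have q: "pmf (map_pmf D Q) x = (\<Sum>z\<in>cube n. \<Sum>y\<in>cube n. w z y * of_bool (D y = x))" for x
    using tr
    by (subst sum.swap) (simp add: pmf_map_finite[OF Q] transports_def sum_distrib_right[symmetric])
  have wP: "w z y = 0" if "z \<in> cube n" "y \<in> cube n" "z \<notin> set_pmf P" for z y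
  proof -
    have "(\<Sum>y\<in>cube n. w z y) = 0" using tr that by (auto simp: transports_def set_pmf_iff)
    then show ?thesis using w0 that by (subst (asm) sum_nonneg_eq_0_iff) auto
  qed
  have "(\<Sum>x\<in>X. \<bar>pmf (map_pmf D P) x - pmf (map_pmf D Q) x\<bar>)
      \<le> (\<Sum>x\<in>X. \<Sum>z\<in>cube n. \<Sum>y\<in>cube n. w z y * \<bar>of_bool (D z = x) - of_bool (D y = x)\<bar>)"
    unfolding p q sum_subtractf[symmetric] right_diff_distrib[symmetric]
    by (intro sum_mono order_trans[OF sum_abs]) (simp add: abs_mult w0)
  also have "\<dots> = (\<Sum>z\<in>cube n. \<Sum>y\<in>cube n. w z y * (\<Sum>x\<in>X. \<bar>of_bool (D z = x) - of_bool (D y = x)\<bar>))"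
    by (subst sum.swap, rule sum.cong[OF refl], subst sum.swap) (simp add: sum_distrib_left)
  finally have *: "tv_distance X (map_pmf D P) (map_pmf D Q) \<le>
    (\<Sum>z\<in>cube n. \<Sum>y\<in>cube n. w z y * (\<Sum>x\<in>X. \<bar>of_bool (D z = x) - of_bool (D y = x)\<bar>)) / 2"
    by (simp add: tv_distance_def)
  have summand: "\<kappa> * (w z y * (\<Sum>x\<in>X. \<bar>of_bool (D z = x) - of_bool (D y = x)\<bar>))
      \<le> 2 * (w z y * rel_hamming n z y)" if zy: "z \<in> cube n" "y \<in> cube n" "\<kappa> > 0" for z y
  proof (cases "D z = D y \<or> z \<notin> set_pmf P")
    case True
    then show ?thesis using w0[OF zy(1,2)] wP[OF zy(1,2)] rel_hamming_nonneg[of n z y] by auto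
  next
    case False
    have "(\<Sum>x\<in>X. \<bar>of_bool (D z = x) - of_bool (D y = x)\<bar> :: real)
        \<le> (\<Sum>x\<in>X. of_bool (D z = x) + of_bool (D y = x))"
      by (intro sum_mono) auto
    also have "\<dots> \<le> 2"
      using X by (simp add: sum.distrib of_bool_def)
    finally have "\<kappa> * (\<Sum>x\<in>X. \<bar>of_bool (D z = x) - of_bool (D y = x)\<bar>) \<le> 2 * rel_hamming n z y"
      using mult_mono[of \<kappa> "rel_hamming n z y" "\<Sum>x\<in>X. \<bar>of_bool (D z = x) - of_bool (D y = x)\<bar>" 2]
       sep[of z y] False zy rel_hamming_nonneg[of n z y] by (auto simp: sum_nonneg)
    from mult_left_mono[OF this w0[OF zy(1,2)]] show ?thesis by (simp add: algebra_simps)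
  qed
  show ?thesis
  proof (cases "\<kappa> > 0")
    case True
    have "\<kappa> * tv_distance X (map_pmf D P) (map_pmf D Q) \<le>
      (\<Sum>z\<in>cube n. \<Sum>y\<in>cube n. \<kappa> * (w z y * (\<Sum>x\<in>X. \<bar>of_bool (D z = x) - of_bool (D y = x)\<bar>))) / 2"
      using mult_left_mono[OF *, of \<kappa>] True by (simp add: sum_distrib_left)
    also have "\<dots> \<le> (\<Sum>z\<in>cube n. \<Sum>y\<in>cube n. 2 * (w z y * rel_hamming n z y)) / 2"
      using True by (intro divide_right_mono sum_mono summand) auto
    finally show ?thesis by (simp add: sum_distrib_left[symmetric])
  next
    case False
    have "\<kappa> * tv_distance X (map_pmf D P) (map_pmf D Q) \<le> 0"
      using False by (intro mult_nonpos_nonneg) (auto simp: tv_distance_def intro!: sum_nonneg)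
    also have "0 \<le> (\<Sum>z\<in>cube n. \<Sum>y\<in>cube n. w z y * rel_hamming n z y)"
      by (intro sum_nonneg mult_nonneg_nonneg w0 rel_hamming_nonneg)
    finally show ?thesis .
  qed
qed

text \<open>The independent coupling. It shows that the set in \<open>doho_distance\<close> is
  nonempty, so that a lower bound on all costs is a lower bound on the infimum.\<close>

lemma product_transports:
  assumes P: "set_pmf P \<subseteq> cube n" and Q: "set_pmf Q \<subseteq> cube n"
  shows "transports n P Q (\<lambda>x y. pmf P x * pmf Q y)"
  using sum_pmf_eq_1[OF finite_cube P] sum_pmf_eq_1[OF finite_cube Q]
  by (simp add: transports_def sum_distrib_left[symmetric] sum_distrib_right[symmetric])

text \<open>The decoder \<open>D\<close> recovers \<open>P\<close> from its encoding and makes a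
  grained distribution of every \<open>Q\<close> in the property. These two are more than
  \<open>\<epsilon>'\<close> apart, and \<open>transport_tv\<close> turns this into transportation
  cost at rate \<kappa>, half of the guaranteed code distance.\<close>

lemma far_from_uniform_on_subset:
  assumes C: "\<And>x. x < N \<Longrightarrow> C x \<in> cube n"
    and dist: "\<And>x y. x < N \<Longrightarrow> y < N \<Longrightarrow> x \<noteq> y \<Longrightarrow> 2 * \<kappa> \<le> rel_hamming n (C x) (C y)"
    and \<kappa>: "\<kappa> > 0" "\<epsilon> < \<kappa> * \<epsilon>'" and P: "set_pmf P \<subseteq> {..<N}"
    and far: "far_from (tv_distance {..<N}) (grained_distributions N m) \<epsilon>' P"
  shows "far_from (doho_distance n) (uniform_on_subset n m) \<epsilon> (map_pmf C P)"
  unfolding far_from_def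
proof
  fix Q assume "Q \<in> uniform_on_subset n m"
  then obtain S where S: "Q = pmf_of_set S" "S \<subseteq> cube n" "card S = m" "S \<noteq> {}"
    by (auto simp: uniform_on_subset_def)
  have fS: "finite S" using S(2) finite_cube by (rule finite_subset)
  have Q: "set_pmf Q \<subseteq> cube n" using S fS by simp
  have N: "N > 0" using P set_pmf_not_empty[of P] by (cases N) auto
  define near where "near y x \<longleftrightarrow> x < N \<and> rel_hamming n (C x) y < \<kappa>" for y x
  \<comment> \<open>A string near no codeword is decoded to the default 0. This keeps
    \<open>D\<close> inside the domain, and \<open>sep\<close> survives because such a string is at
    distance at least \<kappa> from every codeword.\<close>
  define D where "D y = (if \<exists>x. near y x then SOME x. near y x else 0)" for y
  have DN: "D y < N" for y
    using someI_ex[of "near y"] N by (auto simp: D_def near_def)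
  have uniq: "D y = x" if "near y x" for x y
  proof -
    have "near y (D y)" using that someI[of "near y" x] by (auto simp: D_def)
    then have "rel_hamming n (C x) (C (D y)) < 2 * \<kappa>"
      using that rel_hamming_triangle[of n "C x" "C (D y)" y] rel_hamming_commute[of n y]
      by (simp add: near_def)
    then show ?thesis using dist[of x "D y"] that DN by (force simp: near_def)
  qed
  have DC: "D (C x) = x" if "x < N" for x
    using that \<kappa> by (intro uniq) (simp add: near_def)
  have sep: "\<kappa> \<le> rel_hamming n z y" if z: "z \<in> set_pmf (map_pmf C P)" "D z \<noteq> D y" for z y
  proof -
    obtain x where x: "x < N" "z = C x" using z(1) P by auto
    then have "\<not> near y x" using z(2) uniq DC by metis
    then show ?thesis using x by (simp add: near_def)
  qed
  have CP: "set_pmf (map_pmf C P) \<subseteq> cube n" using P C by auto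
  have DP: "map_pmf D (map_pmf C P) = P"
    using P DC unfolding map_pmf_comp by (subst map_pmf_cong[where g = "\<lambda>x. x", OF refl]) auto
  have "map_pmf D Q \<in> grained_distributions N m"
  proof -
    \<comment> \<open>Under the uniform distribution on \<open>S\<close>, the probability of a
      decoded value is the number of its preimages in \<open>S\<close> divided by
      \<open>m\<close>.\<close>
    have "pmf (map_pmf D Q) x = of_int (int (card (S \<inter> D -` {x}))) * (1 / real m)" for x
      using S fS by (simp add: pmf_map measure_pmf_of_set)
    then have "grained m (map_pmf D Q)" unfolding grained_def by blast
    then show ?thesis using DN by (auto simp: grained_distributions_def)
  qed
  then have tv: "\<epsilon>' < tv_distance {..<N} P (map_pmf D Q)" using far by (simp add: far_from_def)
  have "\<kappa> * tv_distance {..<N} P (map_pmf D Q) \<le> doho_distance n (map_pmf C P) Q"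
    unfolding doho_distance_def
  proof (rule cInf_greatest)
    show "{\<Sum>x\<in>cube n. \<Sum>y\<in>cube n. w x y * rel_hamming n x y |w. transports n (map_pmf C P) Q w} \<noteq> {}"
      using product_transports[OF CP Q] by blast
  next
    fix c assume "c \<in> {\<Sum>x\<in>cube n. \<Sum>y\<in>cube n. w x y * rel_hamming n x y |w. transports n (map_pmf C P) Q w}"
    then obtain w where w: "transports n (map_pmf C P) Q w"
      "c = (\<Sum>x\<in>cube n. \<Sum>y\<in>cube n. w x y * rel_hamming n x y)" by blast
    show "\<kappa> * tv_distance {..<N} P (map_pmf D Q) \<le> c"
      using transport_tv[OF w(1) CP Q finite_lessThan[of N], of D \<kappa>] sep unfolding DP w(2) by blast
  qed
  moreover have "\<epsilon> < \<kappa> * tv_distance {..<N} P (map_pmf D Q)"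
    using \<kappa> mult_strict_left_mono[OF tv, of \<kappa>] by linarith
  ultimately show "\<epsilon> < doho_distance n (map_pmf C P) Q" by linarith
qed

section \<open>Simulating a DoHO tester with few full samples\<close>

lemma map_replicate_pmf: "replicate_pmf s (map_pmf f P) = map_pmf (map f) (replicate_pmf s P)"
  by (induction s) (simp_all add: map_bind_pmf bind_map_pmf)

text \<open>The principle of deferred decisions: a sample may be drawn anew at the moment when the
  tree first looks at it.\<close>

lemma replicate_pmf_update:
  assumes "i < s"
  shows "bind_pmf P (\<lambda>v. map_pmf (\<lambda>xs. xs[i := v]) (replicate_pmf s P)) = replicate_pmf s P"
  using assms
proof (induction s arbitrary: i)
  case (Suc s)
  show ?case
  proof (cases i)
    case 0
    then show ?thesis by (simp add: map_bind_pmf)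
  next
    case (Suc j)
    have "bind_pmf P (\<lambda>v. map_pmf (\<lambda>xs. xs[i := v]) (replicate_pmf (Suc s) P)) =
      bind_pmf P (\<lambda>v. bind_pmf P (\<lambda>x. map_pmf (\<lambda>xs. x # xs)
         (map_pmf (\<lambda>xs. xs[j := v]) (replicate_pmf s P))))"
      using Suc by (simp add: map_bind_pmf map_pmf_def bind_assoc_pmf bind_return_pmf)
    also have "\<dots> = bind_pmf P (\<lambda>x. map_pmf (\<lambda>xs. x # xs)
         (bind_pmf P (\<lambda>v. map_pmf (\<lambda>xs. xs[j := v]) (replicate_pmf s P))))"
      by (subst bind_commute_pmf) (simp only: map_bind_pmf)
    also have "\<dots> = replicate_pmf (Suc s) P"
      using Suc Suc.IH[of j] Suc.prems by (simp add: map_pmf_def)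
    finally show ?thesis .
  qed
qed simp

text \<open>Full samples are consumed from the front of the list, one at the first query to each
  index; \<open>known\<close> remembers them for later queries. Thus the number of samples consumed
  is bounded by the depth of the tree instead of by \<open>s\<close>. The samples stay unencoded,
  and \<open>C\<close> is applied only when a bit is read.\<close>

primrec run_lazily ::
  "('a \<Rightarrow> bool list) \<Rightarrow> query_tree \<Rightarrow> (nat \<Rightarrow> 'a option) \<Rightarrow> 'a list \<Rightarrow> bool" where
  "run_lazily C (Output b) known xs = b"
| "run_lazily C (Query i j t u) known xs =
     (case known i of
        Some v \<Rightarrow> if C v ! j then run_lazily C t known xs else run_lazily C u known xs
      | None \<Rightarrow> (let known' = known(i \<mapsto> hd xs) in
          if C (hd xs) ! j then run_lazily C t known' (tl xs) else run_lazily C u known' (tl xs)))"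

definition fill :: "nat \<Rightarrow> (nat \<Rightarrow> 'a option) \<Rightarrow> 'a list \<Rightarrow> 'a list" where
  "fill s known xs = map (\<lambda>i. case known i of Some v \<Rightarrow> v | None \<Rightarrow> xs ! i) [0..<s]"

lemma fill_update:
  assumes "known i = None" "length xs = s"
  shows "fill s known (xs[i := v]) = fill s (known(i \<mapsto> v)) xs"
  using assms by (auto simp: fill_def nth_list_update split: option.splits)

lemma fill_empty: "length xs = s \<Longrightarrow> fill s Map.empty xs = xs"
  by (auto simp: fill_def intro: nth_equalityI)

lemma length_replicate_pmf: "xs \<in> set_pmf (replicate_pmf s P) \<Longrightarrow> length xs = s"
  by (simp add: set_replicate_pmf)

text \<open>At a query to an unknown index, that coordinate is resampled and the new value is moved
  into \<open>known\<close>; on the lazy side it is the head of the list. The list may be longer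
  than the depth, since the two subtrees of a query can have different depths.\<close>

lemma run_lazily_correct:
  assumes "valid_tree s n t" "query_depth t \<le> q"
  shows "map_pmf (\<lambda>xs. run_tree t (map C (fill s known xs))) (replicate_pmf s P) =
    map_pmf (run_lazily C t known) (replicate_pmf q P)"
  using assms
proof (induction t arbitrary: known q)
  case (Query i j t u)
  have i: "i < s" using Query by simp
  show ?case
  proof (cases "known i")
    case (Some v)
    then have "fill s known xs ! i = v" for xs using i by (simp add: fill_def)
    then show ?thesis
      using Query Some i by (cases "C v ! j") (simp_all add: fill_def)
  next
    case None
    obtain q' where q: "q = Suc q'" using Query.prems by (cases q) auto
    let ?F = "\<lambda>known xs. run_tree (Query i j t u) (map C (fill s known xs))"
    have "map_pmf (?F known) (replicate_pmf s P) =
        bind_pmf P (\<lambda>v. map_pmf (\<lambda>xs. ?F known (xs[i := v])) (replicate_pmf s P))"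
      by (subst replicate_pmf_update[OF i, of P, symmetric]) (simp only: map_bind_pmf map_pmf_comp)
    also have "\<dots> = bind_pmf P (\<lambda>v. map_pmf (?F (known(i \<mapsto> v))) (replicate_pmf s P))"
      by (intro bind_pmf_cong map_pmf_cong refl)
         (simp only: fill_update[where known = known, OF None] length_replicate_pmf)
    also have "\<dots> = bind_pmf P (\<lambda>v. map_pmf (\<lambda>xs. run_lazily C (Query i j t u) known (v # xs))
         (replicate_pmf q' P))"
    proof (rule bind_pmf_cong[OF refl])
      fix v
      have "fill s (known(i \<mapsto> v)) xs ! i = v" "length (fill s (known(i \<mapsto> v)) xs) = s" for xs
        using i by (simp_all add: fill_def)
      then show "map_pmf (?F (known(i \<mapsto> v))) (replicate_pmf s P) =
        map_pmf (\<lambda>xs. run_lazily C (Query i j t u) known (v # xs)) (replicate_pmf q' P)"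
        using Query.IH(1)[of q' "known(i \<mapsto> v)"] Query.IH(2)[of q' "known(i \<mapsto> v)"] Query.prems None i q
        by (cases "C v ! j") (simp_all del: fun_upd_apply)
    qed
    also have "\<dots> = map_pmf (run_lazily C (Query i j t u) known) (replicate_pmf q P)"
      by (simp add: q map_bind_pmf map_pmf_def bind_assoc_pmf bind_return_pmf)
    finally show ?thesis .
  qed
qed (simp add: map_pmf_def)

text \<open>The random tree and the samples are independent, so the tree may be drawn after the
  samples, as a standard tester must do.\<close>

lemma standard_simulation:
  assumes "\<forall>t\<in>set_pmf T. valid_tree s n t \<and> query_depth t \<le> q"
  shows "standard_verdict q (\<lambda>xs. map_pmf (\<lambda>t. run_lazily C t Map.empty xs) T) P =
    doho_verdict s T (map_pmf C P)"
proof -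
  have "standard_verdict q (\<lambda>xs. map_pmf (\<lambda>t. run_lazily C t Map.empty xs) T) P =
      bind_pmf T (\<lambda>t. map_pmf (run_lazily C t Map.empty) (replicate_pmf q P))"
    unfolding standard_verdict_def map_pmf_def by (rule bind_commute_pmf)
  also have "\<dots> = bind_pmf T (\<lambda>t. map_pmf (\<lambda>xs. run_tree t (map C (fill s Map.empty xs))) (replicate_pmf s P))"
    using assms by (intro bind_pmf_cong refl run_lazily_correct[symmetric, where n = n]) auto
  also have "\<dots> = bind_pmf T (\<lambda>t. map_pmf (\<lambda>xs. run_tree t (map C xs)) (replicate_pmf s P))"
    by (intro bind_pmf_cong map_pmf_cong refl) (simp add: fill_empty length_replicate_pmf)
  finally show ?thesis
    by (simp add: doho_verdict_def map_replicate_pmf map_pmf_comp)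
qed

section \<open>Amplification by a majority of three runs\<close>

lemma pmf_bool_sum: "pmf V True + pmf V False = 1"
  using sum_pmf_eq_1[OF finite subset_UNIV, of V] unfolding UNIV_bool by simp

definition majority :: "bool \<Rightarrow> bool \<Rightarrow> bool \<Rightarrow> bool" where
  "majority a b c \<longleftrightarrow> a \<and> b \<or> a \<and> c \<or> b \<and> c"

definition repeat3 :: "bool pmf \<Rightarrow> bool pmf" where
  "repeat3 V = bind_pmf V (\<lambda>a. bind_pmf V (\<lambda>b. map_pmf (majority a b) V))"

text \<open>The samples are cut into three independent blocks, one for each run. What remains is to
  interchange independent draws until each run stands next to its own block.\<close>

lemma ex_standard_repeat3:
  fixes T :: "'a list \<Rightarrow> bool pmf"
  shows "\<exists>T'. \<forall>P. standard_verdict (3 * q) T' P = repeat3 (standard_verdict q T P)"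
proof -
  define T' where "T' xs = bind_pmf (T (take q xs)) (\<lambda>a. bind_pmf (T (take q (drop q xs)))
     (\<lambda>b. map_pmf (majority a b) (T (drop q (drop q xs)))))" for xs
  have "standard_verdict (3 * q) T' P = repeat3 (standard_verdict q T P)" for P
  proof -
    let ?R = "replicate_pmf q P"
    have q3: "3 * q = q + (q + q)" by simp
    have "standard_verdict (3 * q) T' P = bind_pmf ?R (\<lambda>xs. bind_pmf ?R (\<lambda>ys. bind_pmf ?R (\<lambda>zs.
        T' (xs @ ys @ zs))))"
      unfolding standard_verdict_def q3 replicate_pmf_distrib by (simp add: bind_assoc_pmf bind_return_pmf)
    also have "\<dots> = bind_pmf ?R (\<lambda>xs. bind_pmf ?R (\<lambda>ys. bind_pmf ?R (\<lambda>zs.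
        bind_pmf (T xs) (\<lambda>a. bind_pmf (T ys) (\<lambda>b. map_pmf (majority a b) (T zs))))))"
      by (intro bind_pmf_cong refl) (simp add: T'_def length_replicate_pmf)
    also have "\<dots> = bind_pmf ?R (\<lambda>xs. bind_pmf ?R (\<lambda>ys.
        bind_pmf (T xs) (\<lambda>a. bind_pmf ?R (\<lambda>zs. bind_pmf (T ys) (\<lambda>b. map_pmf (majority a b) (T zs))))))"
      by (subst (3) bind_commute_pmf) (rule refl)
    also have "\<dots> = bind_pmf ?R (\<lambda>xs. bind_pmf ?R (\<lambda>ys.
        bind_pmf (T xs) (\<lambda>a. bind_pmf (T ys) (\<lambda>b. bind_pmf ?R (\<lambda>zs. map_pmf (majority a b) (T zs))))))"
      by (subst (4) bind_commute_pmf) (rule refl)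
    also have "\<dots> = bind_pmf ?R (\<lambda>xs. bind_pmf (T xs) (\<lambda>a. bind_pmf ?R (\<lambda>ys.
         bind_pmf (T ys) (\<lambda>b. bind_pmf ?R (\<lambda>zs. map_pmf (majority a b) (T zs))))))"
      by (subst (2) bind_commute_pmf) (rule refl)
    also have "\<dots> = repeat3 (standard_verdict q T P)"
      by (simp add: repeat3_def standard_verdict_def bind_assoc_pmf map_bind_pmf)
    finally show ?thesis .
  qed
  then show ?thesis by blast
qed

lemma pmf_repeat3:
  "pmf (repeat3 V) v = 3 * (pmf V v)\<^sup>2 - 2 * (pmf V v) ^ 3"
proof -
  have F: "pmf V False = 1 - pmf V True"
    using pmf_bool_sum[of V] by simp
  have int: "measure_pmf.expectation V g = pmf V True * g True + pmf V False * g False" for g :: "bool \<Rightarrow> real"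
    by (subst integral_measure_pmf[of UNIV]) (auto simp: UNIV_bool)
  have m: "pmf (map_pmf (majority a b) V) w =
     (if majority a b True = w then pmf V True else 0) + (if majority a b False = w then pmf V False else 0)" for a b w
    by (simp add: pmf_bind map_pmf_def int)
  show ?thesis
    by (cases v) (simp_all add: repeat3_def pmf_bind int m majority_def F power2_eq_square power3_eq_cube algebra_simps)
qed

text \<open>The threshold 31/50 lies below 2/3 - 1/25, which is what acceptance retains when
  \<open>q / n\<close> is at most 1/25. At 31/50 the polynomial of \<open>pmf_repeat3\<close> has
  the value 10571/15625, slightly above 2/3; the difference from this value is factored by
  \<open>p - 31/50\<close>.\<close>

lemma pmf_repeat3_ge:
  assumes "pmf V v \<ge> 31 / 50"
  shows "pmf (repeat3 V) v \<ge> 2 / 3"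
proof -
  define p where "p = pmf V v"
  have p: "31/50 \<le> p" "p \<le> 1" using assms by (simp_all add: p_def pmf_le_1)
  have pp: "p * p \<le> p" using p by (simp add: mult_left_le)
  have "0 \<le> 3 * (p + 31/50) - 2 * (p * p + p * (31/50) + (31/50)\<^sup>2)"
    unfolding power2_eq_square using p pp by argo
  then have "(p - 31/50) * (3 * (p + 31/50) - 2 * (p * p + p * (31/50) + (31/50)\<^sup>2)) \<ge> 0"
    using p by (intro mult_nonneg_nonneg) auto
  moreover have "3 * p\<^sup>2 - 2 * p ^ 3 = (p - 31/50) * (3 * (p + 31/50) - 2 * (p * p + p * (31/50) + (31/50)\<^sup>2))
      + 10571 / 15625"
    by algebra
  ultimately have "2 / 3 \<le> 3 * p\<^sup>2 - 2 * p ^ 3" by linarith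
  then show ?thesis by (simp add: pmf_repeat3 p_def)
qed

section \<open>Acceptance of encoded grained distributions\<close>

lemma grained_imp_map_uniform:
  assumes P: "P \<in> grained_distributions N m" and m: "m > 0"
  obtains x where "\<And>k. k < m \<Longrightarrow> x k < N" "P = map_pmf x (pmf_of_set {..<m})"
proof -
  have sP: "set_pmf P \<subseteq> {..<N}" using P by (simp add: grained_distributions_def)
  have "\<exists>k::nat. pmf P y = real k / real m" for y
  proof -
    obtain k :: int where k: "pmf P y = of_int k * (1 / real m)"
      using P by (auto simp: grained_distributions_def grained_def)
    then have "k \<ge> 0" using m pmf_nonneg[of P y] by (simp add: zero_le_divide_iff)
    with k show ?thesis by (intro exI[of _ "nat k"]) simp
  qed
  then obtain k :: "nat \<Rightarrow> nat" where k: "\<And>y. pmf P y = real (k y) / real m" by metis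
  \<comment> \<open>The mass at \<open>y\<close> is cut into \<open>k y\<close> atoms of weight
    \<open>1/m\<close>. There are \<open>m\<close> atoms in total, and \<open>fst\<close> sends each
    to its point; numbering the atoms gives the map.\<close>
  define S where "S = Sigma {..<N} (\<lambda>y. {..<k y})"
  have fS: "finite S" by (simp add: S_def)
  have "real (\<Sum>y<N. k y) / real m = (\<Sum>y<N. pmf P y)"
    by (simp add: k sum_divide_distrib)
  also have "\<dots> = 1" using sP by (intro sum_pmf_eq_1) auto
  finally have "real (\<Sum>y<N. k y) = real m" using m by (simp add: field_simps)
  then have cS: "card S = m" unfolding S_def by (simp only: of_nat_eq_iff) simp
  obtain h where h: "bij_betw h {..<m} S"
    using finite_same_card_bij[of "{..<m}" S] fS cS by auto
  have ne: "S \<noteq> {}" using cS m by auto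
  have "P = map_pmf fst (pmf_of_set S)"
  proof (rule pmf_eqI)
    fix y
    have "card (S \<inter> fst -` {y}) = k y"
    proof (cases "y < N")
      case True
      then have "S \<inter> fst -` {y} = Pair y ` {..<k y}" by (auto simp: S_def)
      then show ?thesis by (simp add: card_image inj_on_def)
    next
      case False
      then have "pmf P y = 0" using sP by (auto simp: pmf_eq_0_set_pmf)
      then have "k y = 0" using k m by simp
      moreover have "S \<inter> fst -` {y} = {}" using False by (auto simp: S_def)
      ultimately show ?thesis by simp
    qed
    then show "pmf P y = pmf (map_pmf fst (pmf_of_set S)) y"
      using fS ne by (simp add: pmf_map measure_pmf_of_set cS k)
  qed
  also have "\<dots> = map_pmf (\<lambda>i. fst (h i)) (pmf_of_set {..<m})"
    using map_pmf_of_set_bij_betw[OF h] m by (simp add: map_pmf_comp[symmetric] lessThan_empty_iff)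
  finally have P: "P = map_pmf (\<lambda>i. fst (h i)) (pmf_of_set {..<m})" .
  have "fst (h i) < N" if "i < m" for i
    using bij_betwE[OF h] that by (force simp: S_def)
  then show thesis using that P by metis
qed

text \<open>Follow the path that \<open>t\<close> takes on \<open>xs\<close>. The output can change
  only if some query on this path is answered differently, and each query has at most one such
  \<open>r\<close>.\<close>

lemma card_run_tree_differ:
  assumes "valid_tree s n t" "finite R"
    and "\<And>i j. i < s \<Longrightarrow> j < n \<Longrightarrow> card {r \<in> R. ys r ! i ! j \<noteq> xs ! i ! j} \<le> 1"
  shows "card {r \<in> R. run_tree t (ys r) \<noteq> run_tree t xs} \<le> query_depth t"
  using assms
proof (induction t)
  case (Query i j t u)
  let ?v = "if xs ! i ! j then t else u"
  have "card {r \<in> R. run_tree (Query i j t u) (ys r) \<noteq> run_tree (Query i j t u) xs}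
      \<le> card ({r \<in> R. ys r ! i ! j \<noteq> xs ! i ! j} \<union> {r \<in> R. run_tree ?v (ys r) \<noteq> run_tree ?v xs})"
    using Query.prems(2) by (intro card_mono) auto
  also have "\<dots> \<le> card {r \<in> R. ys r ! i ! j \<noteq> xs ! i ! j} + card {r \<in> R. run_tree ?v (ys r) \<noteq> run_tree ?v xs}"
    by (rule card_Un_le)
  also have "\<dots> \<le> 1 + query_depth ?v"
    using Query by (intro add_mono) auto
  also have "\<dots> \<le> query_depth (Query i j t u)" by simp
  finally show ?case .
qed simp

section \<open>Flipping one bit per string and averaging over the shifts\<close>

definition flip :: "bool list \<Rightarrow> nat \<Rightarrow> bool list" where
  "flip y i = y[i := \<not> y ! i]"

lemma flip_nth:
  "i < length y \<Longrightarrow> flip y i ! i \<longleftrightarrow> \<not> y ! i"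
  "j \<noteq> i \<Longrightarrow> flip y i ! j = y ! j"
  by (simp_all add: flip_def)

lemma flip_in_cube: "y \<in> cube n \<Longrightarrow> flip y i \<in> cube n"
  by (simp add: flip_def cube_def)

lemma rel_hamming_flip: "y \<in> cube n \<Longrightarrow> rel_hamming n y (flip y i) \<le> 1 / real n"
proof -
  assume y: "y \<in> cube n"
  have "card {j. j < n \<and> y ! j \<noteq> flip y i ! j} \<le> card {i}"
    by (intro card_mono) (auto dest: flip_nth(2)[of _ i y])
  then show ?thesis by (simp add: rel_hamming_def divide_right_mono)
qed

lemma flip_inj:
  assumes "y \<in> cube n" "i < n" "j < n" "flip y i = flip y j"
  shows "i = j"
proof (rule ccontr)
  assume "i \<noteq> j"
  then have "flip y i ! i = (\<not> y ! i)" "flip y j ! i = y ! i"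
    using assms(1,2) \<open>i \<noteq> j\<close> by (simp_all add: flip_nth cube_def)
  with assms(4) show False by simp
qed

lemma add_mod_inj:
  assumes "(k + r) mod n = (k + r') mod n" "r < n" "r' < (n::nat)"
  shows "r = r'"
proof (cases r r' rule: linorder_cases)
  case less
  then have "n dvd r' - r" using assms(1) mod_eq_dvd_iff_nat[of "k + r" "k + r'" n] by simp
  then show ?thesis using less assms(3) nat_dvd_not_less[of "r' - r" n] by simp
next
  case greater
  then have "n dvd r - r'" using assms(1) mod_eq_dvd_iff_nat[of "k + r'" "k + r" n] by simp
  then show ?thesis using greater assms(2) nat_dvd_not_less[of "r - r'" n] by simp
qed

text \<open>Double counting: by linearity of expectation the sum is the expected number of events
  that occur.\<close>

lemma sum_measure_le:
  assumes "finite R" "\<And>z. z \<in> set_pmf J \<Longrightarrow> real (card {r \<in> R. z \<in> B r}) \<le> c"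
  shows "(\<Sum>r\<in>R. measure (measure_pmf J) (B r)) \<le> c"
proof -
  have "(\<Sum>r\<in>R. measure (measure_pmf J) (B r)) = (\<Sum>r\<in>R. measure_pmf.expectation J (indicator (B r)))"
    by simp
  also have "\<dots> = measure_pmf.expectation J (\<lambda>z. \<Sum>r\<in>R. indicator (B r) z)"
    by (subst Bochner_Integration.integral_sum) (auto intro!: measure_pmf.integrable_const_bound[where B = 1] AE_I2)
  also have "\<dots> = measure_pmf.expectation J (\<lambda>z. real (card {r \<in> R. z \<in> B r}))"
  proof (intro Bochner_Integration.integral_cong refl)
    fix z
    have "{r \<in> R. z \<in> B r} = R \<inter> {r. z \<in> B r}" by auto
    then show "(\<Sum>r\<in>R. indicator (B r) z) = real (card {r \<in> R. z \<in> B r})"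
      using assms(1) by (simp add: indicator_def sum_of_bool_eq)
  qed
  also have "\<dots> \<le> c"
    using assms
    by (intro measure_pmf.integral_le_const measure_pmf.integrable_const_bound[where B = "real (card R)"])
      (auto simp: AE_measure_pmf_iff intro!: card_mono)
  finally show ?thesis .
qed

text \<open>Trees and sample indices form one probability space that does not depend on
  \<open>g\<close>. This couples the runs on all the shifted distributions with the run on the
  encoding itself.\<close>

lemma doho_verdict_map:
  "doho_verdict s T (map_pmf g U) =
     map_pmf (\<lambda>(t, ks). run_tree t (map g ks)) (pair_pmf T (replicate_pmf s U))"
  unfolding doho_verdict_def pair_pmf_def map_replicate_pmf map_bind_pmf map_pmf_comp
  by (simp add: map_pmf_def bind_return_pmf)

lemma accept_grained:
  assumes C: "\<And>x. x < N \<Longrightarrow> C x \<in> cube n"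
    and dist: "\<And>x y. x < N \<Longrightarrow> y < N \<Longrightarrow> x \<noteq> y \<Longrightarrow> 2 / real n < rel_hamming n (C x) (C y)"
    and m: "0 < m" "m \<le> n"
    and P: "P \<in> grained_distributions N m"
    and T: "\<forall>t\<in>set_pmf T. valid_tree s n t \<and> query_depth t \<le> q"
    and accept: "\<And>P. P \<in> uniform_on_subset n m \<Longrightarrow> 2/3 \<le> pmf (doho_verdict s T P) True"
  shows "2/3 - real q / real n \<le> pmf (doho_verdict s T (map_pmf C P)) True"
proof -
  obtain x where x: "\<And>k. k < m \<Longrightarrow> x k < N" "P = map_pmf x (pmf_of_set {..<m})"
    using grained_imp_map_uniform[OF P m(1)] by blast
  let ?U = "pmf_of_set {..<m}"
  let ?J = "pair_pmf T (replicate_pmf s ?U)"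
  have U: "set_pmf ?U = {..<m}" using m by (simp add: lessThan_empty_iff)
  define g where "g r k = flip (C (x k)) ((k + r) mod n)" for r k
  define A where "A = {z. run_tree (fst z) (map (\<lambda>k. C (x k)) (snd z))}"
  define B where "B r = {z. run_tree (fst z) (map (g r) (snd z))}" for r
  have g_cube: "g r k \<in> cube n" if "k < m" for r k using x that C by (simp add: g_def flip_in_cube)
  \<comment> \<open>Here \<open>x\<close> itself need not be injective. Distinct codewords are more
    than \<open>2/n\<close> apart and remain distinct after one flip in each; copies of one codeword
    are flipped at different positions because \<open>m \<le> n\<close>.\<close>
  have inj: "inj_on (g r) {..<m}" for r
  proof (rule inj_onI)
    fix k l assume kl: "k \<in> {..<m}" "l \<in> {..<m}" and eq: "g r k = g r l"
    then have xk: "x k < N" "x l < N" using x by auto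
    have "rel_hamming n (C (x k)) (C (x l)) \<le>
        rel_hamming n (C (x k)) (g r k) + rel_hamming n (C (x l)) (g r l)"
      using rel_hamming_triangle[of n "C (x k)" "C (x l)" "g r k"] eq
      by (simp add: rel_hamming_commute)
    also have "\<dots> \<le> 1 / n + 1 / n"
      unfolding g_def using xk C by (intro add_mono rel_hamming_flip) auto
    finally have "x k = x l" using dist[OF xk] by force
    then have "(k + r) mod n = (l + r) mod n"
      using eq C[OF xk(1)] m by (intro flip_inj[of "C (x k)" n]) (auto simp: g_def)
    then show "k = l" using add_mod_inj[of r k n l] kl m by (simp add: add.commute)
  qed
  have B: "2/3 \<le> measure (measure_pmf ?J) (B r)" for r
  proof -
    have "map_pmf (g r) ?U = pmf_of_set (g r ` {..<m})"
      using m by (intro map_pmf_of_set_inj inj) (auto simp: lessThan_empty_iff)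
    also have "\<dots> \<in> uniform_on_subset n m"
      unfolding uniform_on_subset_def using g_cube m inj[of r]
      by (auto intro!: exI[of _ "g r ` {..<m}"] simp: card_image lessThan_empty_iff)
    finally have "2/3 \<le> pmf (doho_verdict s T (map_pmf (g r) ?U)) True" by (rule accept)
    also have "\<dots> = measure (measure_pmf ?J) (B r)"
      unfolding doho_verdict_map pmf_map
      by (simp add: B_def vimage_def case_prod_beta)
    finally show ?thesis .
  qed
  have A: "pmf (doho_verdict s T (map_pmf C P)) True = measure (measure_pmf ?J) A"
    unfolding x(2) map_pmf_comp doho_verdict_map pmf_map
    by (simp add: A_def vimage_def case_prod_beta)
  \<comment> \<open>On \<open>B r - A\<close> the shifted input is accepted and the encoded one
    rejected, so the tree has noticed the flips. Each outcome allows this for at most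
    \<open>q\<close> of the \<open>n\<close> shifts.\<close>
  have "(\<Sum>r<n. measure (measure_pmf ?J) (B r - A)) \<le> real q"
  proof (rule sum_measure_le)
    fix z assume "z \<in> set_pmf ?J"
    then obtain t ks where z: "z = (t, ks)" "t \<in> set_pmf T" "set ks \<subseteq> {..<m}" "length ks = s"
      by (auto simp: set_replicate_pmf U in_lists_conv_set)
    have "card {r \<in> {..<n}. z \<in> B r - A} \<le> card {r \<in> {..<n}.
        run_tree t (map (g r) ks) \<noteq> run_tree t (map (\<lambda>k. C (x k)) ks)}"
      by (intro card_mono) (auto simp: z A_def B_def)
    also have "\<dots> \<le> query_depth t"
    proof (rule card_run_tree_differ[of s n])
      fix i j assume ij: "i < s" "j < n"
      let ?E = "{r \<in> {..<n}. map (g r) ks ! i ! j \<noteq> map (\<lambda>k. C (x k)) ks ! i ! j}"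
      have "(ks ! i + r) mod n = j" if "r \<in> ?E" for r
        using that z(4) ij by (cases "(ks ! i + r) mod n = j") (auto simp: g_def flip_nth)
      then have "r = r'" if "r \<in> ?E" "r' \<in> ?E" for r r'
        using that add_mod_inj[of "ks ! i" r n r'] by auto
      then show "card ?E \<le> 1" by (subst card_le_Suc0_iff_eq[unfolded One_nat_def[symmetric]]) auto
    qed (use T z in auto)
    also have "\<dots> \<le> q" using T z by auto
    finally show "real (card {r \<in> {..<n}. z \<in> B r - A}) \<le> real q" by simp
  qed simp
  moreover have "2/3 - measure (measure_pmf ?J) A \<le> measure (measure_pmf ?J) (B r - A)" for r
  proof -
    have "measure (measure_pmf ?J) (B r) \<le> measure (measure_pmf ?J) (A \<union> (B r - A))"
      by (intro measure_pmf.finite_measure_mono) auto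
    also have "\<dots> \<le> measure (measure_pmf ?J) A + measure (measure_pmf ?J) (B r - A)"
      by (intro measure_Un_le) auto
    finally show ?thesis using B[of r] by linarith
  qed
  then have "(\<Sum>r<n. 2/3 - measure (measure_pmf ?J) A) \<le> (\<Sum>r<n. measure (measure_pmf ?J) (B r - A))"
    by (intro sum_mono)
  ultimately have "real n * (2/3 - measure (measure_pmf ?J) A) \<le> real q" by simp
  then have "2/3 - measure (measure_pmf ?J) A \<le> real q / real n"
    using m by (simp add: pos_le_divide_eq mult.commute)
  then show ?thesis using A by simp
qed

section \<open>The lower bound\<close>

lemma uniform_on_subset_cube:
  "P \<in> uniform_on_subset n m \<Longrightarrow> set_pmf P \<subseteq> cube n"
  unfolding uniform_on_subset_def using finite_subset[OF _ finite_cube]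
  by (smt (verit) mem_Collect_eq set_pmf_of_set)

text \<open>The reduction for \<open>q\<close> at most \<open>n/25\<close>; larger \<open>q\<close>
  satisfy the final bound directly. The factor 3 pays for the majority vote.\<close>

lemma sample_complexity_le_doho:
  assumes C: "\<And>x. x < N \<Longrightarrow> C x \<in> cube n"
    and dist: "\<And>x y. x < N \<Longrightarrow> y < N \<Longrightarrow> x \<noteq> y \<Longrightarrow> 1/8 \<le> rel_hamming n (C x) (C y)"
    and m: "0 < m" "m \<le> n" and n: "16 < n" and \<epsilon>: "\<epsilon> < \<epsilon>' / 16"
    and tester: "doho_tester n (uniform_on_subset n m) \<epsilon> s q T" and q: "25 * q \<le> n"
  shows "sample_complexity {..<N} (grained_distributions N m) \<epsilon>' \<le> enat (3 * q)"
proof -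
  have T: "\<forall>t\<in>set_pmf T. valid_tree s n t \<and> query_depth t \<le> q"
    and tests: "tests (cube n) (doho_distance n) (uniform_on_subset n m) \<epsilon> (doho_verdict s T)"
    using tester by (auto simp: doho_tester_def)
  have "\<exists>T'. \<forall>P. standard_verdict (3 * q) T' P = repeat3 (doho_verdict s T (map_pmf C P))"
    using ex_standard_repeat3[of q "\<lambda>xs. map_pmf (\<lambda>t. run_lazily C t Map.empty xs) T"]
    unfolding standard_simulation[OF T] .
  then obtain T' where T': "\<And>P. standard_verdict (3 * q) T' P = repeat3 (doho_verdict s T (map_pmf C P))"
    by blast
  have "tests {..<N} (tv_distance {..<N}) (grained_distributions N m) \<epsilon>' (standard_verdict (3 * q) T')"
    unfolding tests_def T'
  proof (intro conjI allI impI)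
    fix P assume P: "P \<in> grained_distributions N m"
    \<comment> \<open>For \<open>n > 16\<close> the code distance exceeds the effect of two
      flips.\<close>
    have "2 / real n < 1/8" using n by (simp add: field_simps)
    then have "2/3 - real q / real n \<le> pmf (doho_verdict s T (map_pmf C P)) True"
      using tests dist uniform_on_subset_cube
      by (intro accept_grained[OF C _ m P T]) (force simp: tests_def)+
    moreover have "25 * real q \<le> real n" using q by linarith
    then have "real q / real n \<le> 1/25" using n by (simp add: field_simps)
    ultimately show "2/3 \<le> pmf (repeat3 (doho_verdict s T (map_pmf C P))) True"
      by (intro pmf_repeat3_ge) linarith
  next
    fix P assume P: "set_pmf P \<subseteq> {..<N}"
      and far: "far_from (tv_distance {..<N}) (grained_distributions N m) \<epsilon>' P"
    have "far_from (doho_distance n) (uniform_on_subset n m) \<epsilon> (map_pmf C P)"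
      using C dist \<epsilon> by (intro far_from_uniform_on_subset[where \<kappa> = "1/16", OF _ _ _ _ P far]) auto
    moreover have "set_pmf (map_pmf C P) \<subseteq> cube n" using P C by auto
    ultimately have "2/3 \<le> pmf (doho_verdict s T (map_pmf C P)) False"
      using tests by (simp add: tests_def)
    then show "2/3 \<le> pmf (repeat3 (doho_verdict s T (map_pmf C P))) False"
      by (intro pmf_repeat3_ge) linarith
  qed
  then show ?thesis unfolding sample_complexity_def by (intro INF_lower) blast
qed

section \<open>Impossibility of testing without queries\<close>

lemma far_from_grained_half_grain:
  assumes m: "m > 0"
  defines "P \<equiv> map_pmf (\<lambda>b. if b then 0 else 1) (bernoulli_pmf (1 / (2 * real m)))"
  shows "far_from (tv_distance {..<2}) (grained_distributions 2 m) (1 / (4 * real m)) P"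
  unfolding far_from_def
proof
  fix Q assume Q: "Q \<in> grained_distributions 2 m"
  have P0: "pmf P 0 = 1 / (2 * real m)"
  proof -
    have "(\<lambda>b. if b then 0 else 1 :: nat) -` {0} = {True}" by (auto split: if_splits)
    then show ?thesis using m by (simp add: P_def pmf_map measure_pmf_single)
  qed
  have one: "pmf R 0 + pmf R 1 = 1" if "set_pmf R \<subseteq> {..<2}" for R :: "nat pmf"
    using sum_pmf_eq_1[OF _ that] by (simp add: numeral_2_eq_2)
  have "set_pmf P \<subseteq> {..<2}" by (auto simp: P_def)
  moreover have "set_pmf Q \<subseteq> {..<2}" using Q by (simp add: grained_distributions_def)
  ultimately have tv: "tv_distance {..<2} P Q = \<bar>pmf P 0 - pmf Q 0\<bar>"
    using one[of P] one[of Q] by (simp add: tv_distance_def numeral_2_eq_2)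
  obtain k :: int where k: "pmf Q 0 = of_int k * (1 / real m)"
    using Q by (auto simp: grained_distributions_def grained_def)
  \<comment> \<open>The mass \<open>1/(2m)\<close> is half a grain, midway between two multiples of
    \<open>1/m\<close>: the numerator is odd, hence nonzero.\<close>
  have "pmf P 0 - pmf Q 0 = (1 - 2 * of_int k) / (2 * real m)"
    unfolding P0 k using m by (simp add: field_simps)
  then have "\<bar>pmf P 0 - pmf Q 0\<bar> = \<bar>of_int (1 - 2 * k)\<bar> / (2 * real m)"
    using m by (simp add: abs_divide)
  moreover have "1 \<le> \<bar>1 - 2 * k\<bar>" by presburger
  then have "1 \<le> \<bar>of_int (1 - 2 * k) :: real\<bar>" by linarith
  ultimately have "1 / (2 * real m) \<le> \<bar>pmf P 0 - pmf Q 0\<bar>"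
    using m by (simp add: divide_right_mono)
  moreover have "1 / (4 * real m) < 1 / (2 * real m)" using m by (simp add: field_simps)
  ultimately show "1 / (4 * real m) < tv_distance {..<2} P Q" unfolding tv by linarith
qed

lemma card_cube: "card (cube n) = 2 ^ n"
  using card_lists_length_eq[of "UNIV :: bool set" n] by (simp add: cube_def)

text \<open>Without queries the verdict ignores the input, yet it must accept a uniform distribution
  and reject a far one. The far one puts half a grain on the all-ones string and the rest on the
  all-zeros string; their distance 1 gives \<kappa> = 1/2 and the bound
  \<open>1/(8m)\<close>.\<close>

lemma doho_tester_queries_pos:
  assumes m: "0 < m" "m \<le> n" and \<epsilon>: "\<epsilon> < 1 / (8 * real m)"
    and tester: "doho_tester n (uniform_on_subset n m) \<epsilon> s q T"
  shows "q > 0"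
proof (rule ccontr)
  assume "\<not> q > 0"
  then have T: "query_depth t = 0" if "t \<in> set_pmf T" for t
    using tester that by (auto simp: doho_tester_def)
  have tests: "tests (cube n) (doho_distance n) (uniform_on_subset n m) \<epsilon> (doho_verdict s T)"
    using tester by (auto simp: doho_tester_def)
  have const: "doho_verdict s T P = doho_verdict s T Q" for P Q
    unfolding doho_verdict_def
  proof (rule bind_pmf_cong[OF refl])
    fix t assume "t \<in> set_pmf T"
    then obtain b where "t = Output b" using T by (cases t) force+
    then show "map_pmf (run_tree t) (replicate_pmf s P) = map_pmf (run_tree t) (replicate_pmf s Q)"
      by (simp add: map_pmf_def)
  qed
  have "m \<le> card (cube n)" using m(2) less_exp[of n] unfolding card_cube by linarith
  then obtain S where S: "S \<subseteq> cube n" "card S = m" by (meson obtain_subset_with_card_n)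
  then have "pmf_of_set S \<in> uniform_on_subset n m"
    using m by (auto simp: uniform_on_subset_def)
  then have acc: "2/3 \<le> pmf (doho_verdict s T (pmf_of_set S)) True"
    using tests uniform_on_subset_cube by (simp add: tests_def)
  define P :: "nat pmf" where "P = map_pmf (\<lambda>b. if b then 0 else 1) (bernoulli_pmf (1 / (2 * real m)))"
  define C where "C x = replicate n (x = (0::nat))" for x
  have C: "C x \<in> cube n" for x by (simp add: C_def cube_def)
  have "far_from (doho_distance n) (uniform_on_subset n m) \<epsilon> (map_pmf C P)"
  proof (rule far_from_uniform_on_subset[where N = 2 and \<kappa> = "1/2" and \<epsilon>' = "1 / (4 * real m)"])
    fix x y :: nat assume "x < 2" "y < 2" "x \<noteq> y"
    then have "{i. i < n \<and> C x ! i \<noteq> C y ! i} = {..<n}" by (auto simp: C_def)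
    then show "2 * (1/2) \<le> rel_hamming n (C x) (C y)" using m by (simp add: rel_hamming_def)
  next
    show "set_pmf P \<subseteq> {..<2}" by (auto simp: P_def)
  qed (use C \<epsilon> far_from_grained_half_grain[OF m(1)] in \<open>simp_all add: P_def\<close>)
  moreover have "set_pmf (map_pmf C P) \<subseteq> cube n" using C by auto
  ultimately have "2/3 \<le> pmf (doho_verdict s T (map_pmf C P)) False"
    using tests by (simp add: tests_def)
  moreover have "2/3 \<le> pmf (doho_verdict s T (map_pmf C P)) True"
    using acc const by metis
  ultimately show False using pmf_bool_sum[of "doho_verdict s T (map_pmf C P)"] by linarith
qed

text \<open>Without any tester the complexity is infinite; otherwise the infimum is attained because
  \<open>enat\<close> is well-ordered.\<close>

lemma le_doho_query_complexityI:
  assumes "\<And>q s T. doho_tester n \<P> \<epsilon> s q T \<Longrightarrow> x \<le> real q"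
  shows "ereal x \<le> ereal_of_enat (doho_query_complexity n \<P> \<epsilon>)"
proof (cases "{q. \<exists>s T. doho_tester n \<P> \<epsilon> s q T} = {}")
  case True
  then show ?thesis by (simp add: doho_query_complexity_def top_enat_def)
next
  case False
  then have "doho_query_complexity n \<P> \<epsilon> \<in> enat ` {q. \<exists>s T. doho_tester n \<P> \<epsilon> s q T}"
    unfolding doho_query_complexity_def by (auto intro!: wellorder_InfI)
  then show ?thesis using assms by auto
qed

theorem theorem2p13:
  fixes N :: "nat \<Rightarrow> nat" and \<epsilon>\<^sub>0 :: real
  assumes domain_size: "(\<lambda>m. real (N m)) \<in> O(\<lambda>m. real m)"
    and "\<epsilon>\<^sub>0 > 0"
    and grained_lower_bound:
      "\<exists>c>0. \<forall>\<^sub>F m in sequentially.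
         ereal (c * (real m / ln (real m))) \<le>
         ereal_of_enat (sample_complexity {..<N m} (grained_distributions (N m) m) \<epsilon>\<^sub>0)"
  shows "\<exists>\<epsilon>>0. \<exists>c>0. \<forall>m n. m \<le> n \<longrightarrow>
         ereal (c * (real m / ln (real m))) \<le>
         ereal_of_enat (doho_query_complexity n (uniform_on_subset n m) \<epsilon>)"
proof -
  obtain K where "\<forall>\<^sub>F m in sequentially. norm (real (N m)) \<le> K * norm (real m)"
    using domain_size by (elim landau_o.bigE)
  then obtain M\<^sub>1 where N: "real (N m) \<le> K * real m" if "m \<ge> M\<^sub>1" for m
    by (auto simp: eventually_sequentially)
  obtain c\<^sub>0 where c\<^sub>0: "c\<^sub>0 > 0" and ev: "\<forall>\<^sub>F m in sequentially. ereal (c\<^sub>0 * (real m / ln (real m))) \<le>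
      ereal_of_enat (sample_complexity {..<N m} (grained_distributions (N m) m) \<epsilon>\<^sub>0)"
    using grained_lower_bound by blast
  then obtain M\<^sub>2 where lower: "ereal (c\<^sub>0 * (real m / ln (real m))) \<le>
      ereal_of_enat (sample_complexity {..<N m} (grained_distributions (N m) m) \<epsilon>\<^sub>0)" if "m \<ge> M\<^sub>2" for m
    by (auto simp: eventually_sequentially)
  \<comment> \<open>From \<open>M\<close> on both asymptotic hypotheses hold, \<open>n\<close>
    exceeds 16, and \<open>16 * K \<le> n\<close> makes the code large enough for \<open>N m\<close>
    points.\<close>
  define M where "M = Max {M\<^sub>1, M\<^sub>2, 17, nat \<lceil>16 * K\<rceil>}"
  have M: "M \<ge> M\<^sub>1" "M \<ge> M\<^sub>2" "M \<ge> 17" "M \<ge> nat \<lceil>16 * K\<rceil>"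
    unfolding M_def by (rule Max_ge; simp)+
  \<comment> \<open>The first bound is below \<open>\<epsilon>\<^sub>0 / 16\<close>, as the
    reduction demands; the second is below \<open>1/(8m)\<close> for all positive
    \<open>m < M\<close>.\<close>
  define \<epsilon> where "\<epsilon> = min (\<epsilon>\<^sub>0 / 32) (1 / (16 * real M))"
  \<comment> \<open>One bound for each case: the reduction with its factor 3, testers with
    \<open>q > n/25\<close>, and small \<open>m\<close>, where one query must suffice for the
    bound.\<close>
  define c where "c = Min {c\<^sub>0 / 3, 1 / 25, 1 / (2 * real M)}"
  have \<epsilon>: "\<epsilon> > 0" using assms(2) M by (simp add: \<epsilon>_def)
  have c0: "c > 0" using c\<^sub>0 M by (simp add: c_def)
  have c: "c \<le> c\<^sub>0 / 3" "c \<le> 1 / 25" "c \<le> 1 / (2 * real M)"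
    unfolding c_def by (rule Min_le; simp)+
  have "ereal (c * (real m / ln (real m))) \<le>
      ereal_of_enat (doho_query_complexity n (uniform_on_subset n m) \<epsilon>)" if mn: "m \<le> n" for m n
  proof (rule le_doho_query_complexityI)
    fix q s T assume tester: "doho_tester n (uniform_on_subset n m) \<epsilon> s q T"
    consider "m \<le> 1" | "2 \<le> m" "m < M" | "M \<le> m" by linarith
    then show "c * (real m / ln (real m)) \<le> real q"
    proof cases
      case 1
      \<comment> \<open>For \<open>m = 1\<close> the denominator \<open>ln 1\<close> is 0, and
        division by zero yields 0, so the bound is trivial in both cases.\<close>
      then have "m = 0 \<or> m = 1" by auto
      then show ?thesis by auto
    next
      case 2
      have "1 / (16 * real M) < 1 / (8 * real m)" using 2 by (simp add: field_simps)
      then have "q > 0" using 2 mn by (intro doho_tester_queries_pos[OF _ _ _ tester]) (auto simp: \<epsilon>_def)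
      \<comment> \<open>This gives \<open>m / ln m \<le> 2 * m\<close>, which the choice of
        \<open>c\<close> brings below 1.\<close>
      have "1/2 \<le> ln (2::real)" by (rule ln_ge_iff[THEN iffD2]) (use exp_bound_half[of "1/2::real"] in auto)
      also have "\<dots> \<le> ln (real m)" using 2 by simp
      finally have "real m / ln (real m) \<le> real m / (1/2)"
        by (intro divide_left_mono) auto
      then have "c * (real m / ln (real m)) \<le> 1 / (2 * real M) * (2 * real m)"
        using c 2 by (intro mult_mono) auto
      also have "\<dots> \<le> 1" using 2 by simp
      also have "1 \<le> real q" using \<open>q > 0\<close> by simp
      finally show ?thesis .
    next
      case 3
      have "exp 1 \<le> real m" using exp_le 3 M by linarith
      then have ln: "1 \<le> ln (real m)" using 3 M by (subst ln_ge_iff) auto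
      then have mln: "0 \<le> real m / ln (real m)" "real m / ln (real m) \<le> real m"
        using mult_left_mono[OF ln, of "real m"] by (auto simp: pos_divide_le_eq)
      have "16 * K \<le> real n" using 3 M mn by linarith
      then have "16 * (K * real m) \<le> real n * real n"
        using mult_mono[of "16 * K" "real n" "real m" "real n"] mn by simp
      then have "real (16 * N m) \<le> real (n\<^sup>2)"
        using N[of m] 3 M by (simp add: power2_eq_square)
      then have "16 * N m \<le> n\<^sup>2" by (simp only: of_nat_le_iff)
      then obtain C where C: "\<And>x. x < N m \<Longrightarrow> C x \<in> cube n"
        "\<And>x y. x < N m \<Longrightarrow> y < N m \<Longrightarrow> x \<noteq> y \<Longrightarrow> 1/8 \<le> rel_hamming n (C x) (C y)"
        using ex_code[of n "N m"] 3 M mn by auto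
      show ?thesis
      proof (cases "25 * q \<le> n")
        case True
        have "sample_complexity {..<N m} (grained_distributions (N m) m) \<epsilon>\<^sub>0 \<le> enat (3 * q)"
          using 3 M mn assms(2) True
          by (intro sample_complexity_le_doho[OF C _ mn _ _ tester]) (auto simp: \<epsilon>_def min_less_iff_disj)
        then have "ereal_of_enat (sample_complexity {..<N m} (grained_distributions (N m) m) \<epsilon>\<^sub>0)
            \<le> ereal_of_enat (enat (3 * q))"
          by (simp only: ereal_of_enat_le_iff)
        then have "ereal (c\<^sub>0 * (real m / ln (real m))) \<le> ereal_of_enat (enat (3 * q))"
          using lower[of m] 3 M by (meson order_trans)
        then have "c\<^sub>0 / 3 * (real m / ln (real m)) \<le> real q" by simp
        then show ?thesis using mult_right_mono[OF c(1) mln(1)] by linarith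
      next
        case False
        then have "1 / 25 * real m \<le> real q" using mn by linarith
        moreover have "c * (real m / ln (real m)) \<le> 1 / 25 * real m"
          using c mln by (intro mult_mono) auto
        ultimately show ?thesis by linarith
      qed
    qed
  qed
  then show ?thesis using \<epsilon> c0 by blast
qed

end
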